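(* Consider a general equation of state $h=\mathcal H(\rho,p)$ satisfying conditions (i)--(iv) of the context. If $\mathbf U=(D,\mathbf m^\top,\mathbf B^\top,E)^\top\in\mathcal G$, then the positive root $\xi_c$ of the cubic polynomial $$f_c(\xi)=\xi^3+(B^2-E)\xi^2-\frac{B^2D^2+\tau^2}{2}$$ always lies in the interval $\Omega_3=(\xi_b,\xi_*]$.
   Context: Conservative vectors are $\mathbf U=(D,\mathbf m^\top,\mathbf B^\top,E)^\top$ with $D,E\in\mathbb R$ and $\mathbf m,\mathbf B\in\mathbb R^3$. Write $m=|\mathbf m|$, $B=|\mathbf B|$, $\tau=\mathbf m\cdot\mathbf B$. The admissible set $\mathcal G$ is the set of all $\mathbf U$ with $D>0$, $E-\sqrt{D^2+m^2}>0$ and $\Psi(\mathbf U)>0$, where $$\Phi(\mathbf U)=\sqrt{(B^2-E)^2+3(E^2-D^2-m^2)},$$ $$\Psi(\mathbf U)=\big(\Phi(\mathbf U)-2(B^2-E)\big)\sqrt{\Phi(\mathbf U)+B^2-E}-\sqrt{\tfrac{27}{2}(D^2B^2+\tau^2)}.$$ Equation of state: $h=\mathcal H(\rho,p)$ for $\rho,p>0$, where (i) $\mathcal H$ is differentiable on $\mathbb R^+\times\mathbb R^+$; (ii) $\mathcal H(\rho,p)\ge\sqrt{1+p^2/\rho^2}+p/\rho$ for all $p,\rho>0$; (iii) $\mathcal H(\rho,p)\big(\frac1\rho-\frac{\partial\mathcal H}{\partial p}(\rho,p)\big)<\frac{\partial\mathcal H}{\partial\rho}(\rho,p)<0$ for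 all $p,\rho>0$; (iv) $\lim_{p\to0^+}\mathcal H(\rho,p)=1$ for all $\rho>0$. Under these conditions, for every $\rho>0$ and $h>1$ there is a unique $p>0$ with $\mathcal H(\rho,p)=h$; it is denoted $p=\mathcal P(\rho,h)$. Define $$f_a(\xi)=\xi^2(\xi+B^2)^2-\big(\xi^2m^2+(2\xi+B^2)\tau^2\big),\qquad f_b(\xi)=f_a(\xi)-D^2(\xi+B^2)^2.$$ For $\mathbf U\in\mathcal G$ it is known that $f_a$ has at least one non-negative root. Let $\xi_a$ be its largest non-negative root; then $\Omega_1:=\{\xi>0:f_a(\xi)>0\}=(\xi_a,+\infty)$. It is known that $f_b$ has a unique root $\xi_b$ in $\Omega_1$; put $\Omega_2:=(\xi_b,+\infty)$. Let $$\mathcal W(\xi)=\frac{\xi(\xi+B^2)}{\sqrt{f_a(\xi)}},\qquad \mathcal F(\xi)=\xi-\mathcal P\Big(\frac{D}{\mathcal W(\xi)},\frac{\xi}{D\mathcal W(\xi)}\Big)-\frac12\Big(\frac{B^2}{\mathcal W(\xi)^2}+\frac{\tau^2}{\xi^2}\Big)+B^2-E.$$ On $\Omega_2$ one has $\xi/(D\mathcal W(\xi))>1$, so $\mathcal F$ is well defined there. It is known that $\mathcal F$ has a unique root in $\Omega_2$, denoted $\xi_*$, and that for $\mathbf U\in\mathcal G$ the polynomial $f_c$ has a unique positive root. *)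

theory Defs
  imports "HOL-Analysis.Analysis"
begin

record conserved =
  dens :: real
  mom :: "real ^ 3"
  mag :: "real ^ 3"
  energy :: real

definition tau :: "conserved \<Rightarrow> real" where
  "tau U = mom U \<bullet> mag U"

definition Phi :: "conserved \<Rightarrow> real" where
  "Phi U = sqrt (((norm (mag U))\<^sup>2 - energy U)\<^sup>2
                 + 3 * ((energy U)\<^sup>2 - (dens U)\<^sup>2 - (norm (mom U))\<^sup>2))"

definition Psi :: "conserved \<Rightarrow> real" where
  "Psi U = (Phi U - 2 * ((norm (mag U))\<^sup>2 - energy U)) * sqrt (Phi U + (norm (mag U))\<^sup>2 - energy U)
           - sqrt (27 / 2 * ((dens U)\<^sup>2 * (norm (mag U))\<^sup>2 + (tau U)\<^sup>2))"

text \<open>On states satisfying the first two conditions the arguments of all square roots in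
  \<open>Phi\<close> and \<open>Psi\<close> are nonnegative, so the convention for \<open>sqrt\<close> of negative numbers is irrelevant.\<close>

definition admissible :: "conserved set" where
  "admissible = {U. dens U > 0 \<and> energy U - sqrt ((dens U)\<^sup>2 + (norm (mom U))\<^sup>2) > 0 \<and> Psi U > 0}"

text \<open>\<open>H \<rho> p\<close> is the specific enthalpy at density \<open>\<rho>\<close> and pressure \<open>p\<close>; its values outside the open
  positive quadrant play no role. Condition (i) is joint (Frechet) differentiability.\<close>

definition equation_of_state :: "(real \<Rightarrow> real \<Rightarrow> real) \<Rightarrow> bool" where
  "equation_of_state H \<longleftrightarrow>
     (\<lambda>(\<rho>, p). H \<rho> p) differentiable_on ({0<..} \<times> {0<..}) \<and>
     (\<forall>\<rho>>0. \<forall>p>0. H \<rho> p \<ge> sqrt (1 + p\<^sup>2 / \<rho>\<^sup>2) + p / \<rho>) \<and>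
     (\<forall>\<rho>>0. \<forall>p>0. H \<rho> p * (1 / \<rho> - deriv (\<lambda>q. H \<rho> q) p) < deriv (\<lambda>r. H r p) \<rho> \<and>
                   deriv (\<lambda>r. H r p) \<rho> < 0) \<and>
     (\<forall>\<rho>>0. ((\<lambda>p. H \<rho> p) \<longlongrightarrow> 1) (at_right 0))"

definition pressure :: "(real \<Rightarrow> real \<Rightarrow> real) \<Rightarrow> real \<Rightarrow> real \<Rightarrow> real" where
  "pressure H \<rho> h = (THE p. p > 0 \<and> H \<rho> p = h)"

definition f_a :: "conserved \<Rightarrow> real \<Rightarrow> real" where
  "f_a U \<xi> = \<xi>\<^sup>2 * (\<xi> + (norm (mag U))\<^sup>2)\<^sup>2
             - (\<xi>\<^sup>2 * (norm (mom U))\<^sup>2 + (2 * \<xi> + (norm (mag U))\<^sup>2) * (tau U)\<^sup>2)"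

definition f_b :: "conserved \<Rightarrow> real \<Rightarrow> real" where
  "f_b U \<xi> = f_a U \<xi> - (dens U)\<^sup>2 * (\<xi> + (norm (mag U))\<^sup>2)\<^sup>2"

definition f_c :: "conserved \<Rightarrow> real \<Rightarrow> real" where
  "f_c U \<xi> = \<xi> ^ 3 + ((norm (mag U))\<^sup>2 - energy U) * \<xi>\<^sup>2
             - ((norm (mag U))\<^sup>2 * (dens U)\<^sup>2 + (tau U)\<^sup>2) / 2"

definition Omega1 :: "conserved \<Rightarrow> real set" where
  "Omega1 U = {\<xi>. \<xi> > 0 \<and> f_a U \<xi> > 0}"

text \<open>The definite descriptions below are justified for admissible states (and, for \<open>xi_star\<close>, for
  an equation of state): in each case there is exactly one such root.\<close>

definition xi_b :: "conserved \<Rightarrow> real" where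
  "xi_b U = (THE \<xi>. \<xi> \<in> Omega1 U \<and> f_b U \<xi> = 0)"

definition Omega2 :: "conserved \<Rightarrow> real set" where
  "Omega2 U = {xi_b U<..}"

definition lorentz :: "conserved \<Rightarrow> real \<Rightarrow> real" where
  "lorentz U \<xi> = \<xi> * (\<xi> + (norm (mag U))\<^sup>2) / sqrt (f_a U \<xi>)"

definition master :: "(real \<Rightarrow> real \<Rightarrow> real) \<Rightarrow> conserved \<Rightarrow> real \<Rightarrow> real" where
  "master H U \<xi> = \<xi> - pressure H (dens U / lorentz U \<xi>) (\<xi> / (dens U * lorentz U \<xi>))
     - 1 / 2 * ((norm (mag U))\<^sup>2 / (lorentz U \<xi>)\<^sup>2 + (tau U)\<^sup>2 / \<xi>\<^sup>2)
     + (norm (mag U))\<^sup>2 - energy U"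

definition xi_star :: "(real \<Rightarrow> real \<Rightarrow> real) \<Rightarrow> conserved \<Rightarrow> real" where
  "xi_star H U = (THE \<xi>. \<xi> \<in> Omega2 U \<and> master H U \<xi> = 0)"

definition xi_c :: "conserved \<Rightarrow> real" where
  "xi_c U = (THE \<xi>. \<xi> > 0 \<and> f_c U \<xi> = 0)"

definition Omega3 :: "(real \<Rightarrow> real \<Rightarrow> real) \<Rightarrow> conserved \<Rightarrow> real set" where
  "Omega3 H U = {xi_b U<..xi_star H U}"

end

theory Submission
  imports Defs
begin

text \<open>On \<open>\<Omega>\<^sub>2\<close> one has \<open>1 / W\<^sup>2 > D\<^sup>2 / \<xi>\<^sup>2\<close>, so the master function plus the pressure is at most
  \<open>f\<^sub>c(\<xi>) / \<xi>\<^sup>2\<close>; it is increasing, hence positive only beyond \<open>\<xi>\<^sub>c\<close>, and at \<open>\<xi>\<^sub>*\<close> it equals the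
  positive pressure. So \<open>\<xi>\<^sub>c \<le> \<xi>\<^sub>*\<close>. That \<open>\<xi>\<^sub>b < \<xi>\<^sub>c\<close>, i.e. \<open>f\<^sub>c(\<xi>\<^sub>b) < 0\<close>, is a reformulation of
  \<open>\<Psi> > 0\<close>: for fixed \<open>D, m, B\<close>, the value of \<open>E\<close> with \<open>f\<^sub>c(\<xi>\<^sub>b) = 0\<close> is the one with \<open>\<Psi> = 0\<close>.\<close>

section \<open>Functions increasing at each of their zeros\<close>

text \<open>Just right of \<open>x\<close> the function is positive. At its first later zero
  \<open>z\<close> the derivative is positive, so the function is negative just left of
  \<open>z\<close>, and the intermediate value theorem yields a zero before \<open>z\<close>. The
  lemma serves \<open>defect\<close>, whose derivative has a known sign only at its zeros.\<close>

lemma zero_unique_if_deriv_pos: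
  fixes f :: "real \<Rightarrow> real"
  assumes "x \<le> y" "f x = 0" "f y = 0"
    and cont: "continuous_on {x..y} f"
    and pos: "\<And>z. x \<le> z \<Longrightarrow> z \<le> y \<Longrightarrow> f z = 0 \<Longrightarrow> \<exists>d>0. (f has_real_derivative d) (at z)"
  shows "x = y"
proof (rule ccontr)
  assume "x \<noteq> y"
  with \<open>x \<le> y\<close> have "x < y" by simp
  obtain d where "d > 0" "(f has_real_derivative d) (at x)"
    using pos[of x] assms by auto
  then obtain e where e: "e > 0" "\<And>h. 0 < h \<Longrightarrow> h < e \<Longrightarrow> f x < f (x + h)"
    using DERIV_pos_inc_right[of f d x] by blast
  define u where "u = x + min (e / 2) ((y - x) / 2)"
  have u: "x < u" "u < y" "f u > 0"
  proof -
    show "x < u" using e \<open>x < y\<close> by (simp add: u_def)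
    show "u < y" using \<open>x < y\<close> by (simp add: u_def min_def field_simps)
    have "f x < f (x + min (e / 2) ((y - x) / 2))"
      using e(1) \<open>x < y\<close> by (intro e(2)) (auto simp: min_def)
    then show "f u > 0" using \<open>f x = 0\<close> by (simp add: u_def)
  qed
  define Z where "Z = {u..y} \<inter> f -` {0}"
  have contu: "continuous_on {u..y} f"
    using cont by (rule continuous_on_subset) (use u in auto)
  have "closed Z"
    using continuous_closed_preimage[OF contu, of "{0}"] by (simp add: Z_def)
  moreover have "y \<in> Z" using u assms by (simp add: Z_def)
  moreover have bb: "bdd_below Z" by (auto simp: Z_def bdd_below_def)
  ultimately have "Inf Z \<in> Z" using closed_contains_Inf[of Z] by blast
  define z where "z = Inf Z"
  have z: "u \<le> z" "z \<le> y" "f z = 0" using \<open>Inf Z \<in> Z\<close> by (auto simp: Z_def z_def)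
  with u have "u < z" by (cases "u = z") auto
  obtain d' where "d' > 0" "(f has_real_derivative d') (at z)"
    using pos[of z] z u by auto
  then obtain e' where e': "e' > 0" "\<And>h. 0 < h \<Longrightarrow> h < e' \<Longrightarrow> f (z - h) < f z"
    using DERIV_pos_inc_left[of f d' z] by blast
  define w where "w = z - min (e' / 2) ((z - u) / 2)"
  have w: "u < w" "w < z"
    using e' \<open>u < z\<close> by (auto simp: w_def min_def field_simps)
  have "f (z - min (e' / 2) ((z - u) / 2)) < f z"
    using e'(1) \<open>u < z\<close> by (intro e'(2)) (auto simp: min_def)
  then have "f w < 0" using z by (simp add: w_def)
  moreover have "continuous_on {u..w} f"
    using contu by (rule continuous_on_subset) (use w z in auto)
  ultimately obtain v where "u \<le> v" "v \<le> w" "f v = 0"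
    using IVT2'[of f w 0 u] u w by auto
  then have "v \<in> Z" using w z by (simp add: Z_def)
  then have "z \<le> v" unfolding z_def using bb by (rule cInf_lower)
  with \<open>v \<le> w\<close> w show False by simp
qed

section \<open>The equation of state\<close>

context
  fixes H :: "real \<Rightarrow> real \<Rightarrow> real"
  assumes eos: "equation_of_state H"
begin

lemma eos_lower:
  assumes "\<rho> > 0" "p > 0"
  shows "2 * p / \<rho> < H \<rho> p" "1 < H \<rho> p"
proof -
  have *: "H \<rho> p \<ge> sqrt (1 + p\<^sup>2 / \<rho>\<^sup>2) + p / \<rho>"
    using eos assms by (simp add: equation_of_state_def)
  have "sqrt (1 + p\<^sup>2 / \<rho>\<^sup>2) > p / \<rho>"
    using assms by (intro real_less_rsqrt) (simp add: power_divide)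
  with * show "2 * p / \<rho> < H \<rho> p" by simp
  have "sqrt (1 + p\<^sup>2 / \<rho>\<^sup>2) \<ge> 1" by simp
  moreover have "p / \<rho> > 0" using assms by simp
  ultimately show "1 < H \<rho> p" using * by linarith
qed

text \<open>Restricting the Frechet derivative to the two coordinate lines identifies its
  coefficients with the \<open>deriv\<close> terms of condition (iii). The joint form matters
  because density and pressure both vary along \<xi>.\<close>

lemma eos_has_derivative:
  assumes "\<rho> > 0" "p > 0"
  shows "((\<lambda>(r, q). H r q) has_derivative
           (\<lambda>(u, v). deriv (\<lambda>r. H r p) \<rho> * u + deriv (\<lambda>q. H \<rho> q) p * v)) (at (\<rho>, p))"
proof -
  have "open ({0<..} \<times> {0<..} :: (real \<times> real) set)" by (intro open_Times) auto
  then have "(\<lambda>(r, q). H r q) differentiable (at (\<rho>, p))"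
    using eos assms unfolding equation_of_state_def
    by (metis (no_types, lifting) SigmaI differentiable_on_eq_differentiable_at greaterThan_iff)
  then obtain L where L: "((\<lambda>(r, q). H r q) has_derivative L) (at (\<rho>, p))"
    by (auto simp: differentiable_def)
  then interpret L: bounded_linear L by (rule has_derivative_bounded_linear)
  have "((\<lambda>r. (\<lambda>(r, q). H r q) (r, p)) has_derivative (\<lambda>u. L (u, 0))) (at \<rho>)"
    by (rule has_derivative_compose[where f = "\<lambda>r. (r, p)"], rule has_derivative_Pair)
       (use L in \<open>auto intro: has_derivative_ident\<close>)
  moreover have Lu: "L (u, 0) = L (1, 0) * u" for u
    using L.scale[of u "(1, 0)"] by (simp add: mult.commute)
  then have "(\<lambda>u. L (u, 0)) = (*) (L (1, 0))" by blast
  ultimately have 1: "deriv (\<lambda>r. H r p) \<rho> = L (1, 0)"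
    by (intro DERIV_imp_deriv) (simp only: has_field_derivative_def prod.case)
  have "((\<lambda>q. (\<lambda>(r, q). H r q) (\<rho>, q)) has_derivative (\<lambda>v. L (0, v))) (at p)"
    by (rule has_derivative_compose[where f = "\<lambda>q. (\<rho>, q)"], rule has_derivative_Pair)
       (use L in \<open>auto intro: has_derivative_ident\<close>)
  moreover have Lv: "L (0, v) = L (0, 1) * v" for v
    using L.scale[of v "(0, 1)"] by (simp add: mult.commute)
  then have "(\<lambda>v. L (0, v)) = (*) (L (0, 1))" by blast
  ultimately have 2: "deriv (\<lambda>q. H \<rho> q) p = L (0, 1)"
    by (intro DERIV_imp_deriv) (simp only: has_field_derivative_def prod.case)
  have "L (u, v) = L (1, 0) * u + L (0, 1) * v" for u v
  proof -
    have "L (u, v) = L (u, 0) + L (0, v)" using L.add[of "(u, 0)" "(0, v)"] by simp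
    also have "\<dots> = L (1, 0) * u + L (0, 1) * v" by (rule arg_cong2[OF Lu Lv])
    finally show ?thesis .
  qed
  then have "L = (\<lambda>(u, v). L (1, 0) * u + L (0, 1) * v)"
    by (intro ext) (metis case_prod_conv surj_pair)
  with L show ?thesis unfolding 1 2 by (rule back_subst)
qed

lemma eos_chain:
  assumes "(r has_real_derivative r') (at x)" "(q has_real_derivative q') (at x)"
    and "r x > 0" "q x > 0"
  shows "((\<lambda>x. H (r x) (q x)) has_real_derivative
           deriv (\<lambda>s. H s (q x)) (r x) * r' + deriv (\<lambda>s. H (r x) s) (q x) * q') (at x)"
proof -
  have "((\<lambda>x. (r x, q x)) has_derivative (\<lambda>h. (r' * h, q' * h))) (at x)"
    using assms by (intro has_derivative_Pair) (simp_all add: has_field_derivative_def)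
  from has_derivative_compose[OF this eos_has_derivative[OF assms(3,4)]]
  have "((\<lambda>x. H (r x) (q x)) has_derivative (\<lambda>h. deriv (\<lambda>s. H s (q x)) (r x) * (r' * h)
      + deriv (\<lambda>s. H (r x) s) (q x) * (q' * h))) (at x)"
    by simp
  then show ?thesis
    unfolding has_field_derivative_def distrib_right mult.assoc .
qed

lemma eos_partials:
  assumes "\<rho> > 0" "p > 0"
  shows "H \<rho> p * (1 / \<rho> - deriv (\<lambda>q. H \<rho> q) p) < deriv (\<lambda>r. H r p) \<rho>"
    and "deriv (\<lambda>r. H r p) \<rho> < 0"
    and "1 / \<rho> < deriv (\<lambda>q. H \<rho> q) p"
proof -
  show 1: "H \<rho> p * (1 / \<rho> - deriv (\<lambda>q. H \<rho> q) p) < deriv (\<lambda>r. H r p) \<rho>"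
    and 2: "deriv (\<lambda>r. H r p) \<rho> < 0"
    using eos assms by (simp_all add: equation_of_state_def)
  have "H \<rho> p * (1 / \<rho> - deriv (\<lambda>q. H \<rho> q) p) < 0" using 1 2 by simp
  then show "1 / \<rho> < deriv (\<lambda>q. H \<rho> q) p"
    using eos_lower[OF assms] by (simp add: mult_less_0_iff)
qed

lemma eos_deriv_pressure:
  assumes "\<rho> > 0" "p > 0"
  shows "((\<lambda>q. H \<rho> q) has_real_derivative deriv (\<lambda>q. H \<rho> q) p) (at p)"
  using eos_chain[of "\<lambda>_. \<rho>" 0 p "\<lambda>q. q" 1] assms by simp

lemma eos_mono_pressure:
  assumes "\<rho> > 0" "0 < p" "p < q"
  shows "H \<rho> p < H \<rho> q"
proof (rule DERIV_pos_imp_increasing[OF \<open>p < q\<close>])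
  fix x assume "p \<le> x" "x \<le> q"
  then have "x > 0" using assms by simp
  moreover have "0 < 1 / \<rho>" using assms by simp
  ultimately show "\<exists>d. ((\<lambda>q. H \<rho> q) has_real_derivative d) (at x) \<and> 0 < d"
    using eos_deriv_pressure[of \<rho> x] eos_partials(3)[of \<rho> x] assms
    by (metis order_less_trans)
qed

lemma eos_antimono_density:
  assumes "0 < \<rho>" "\<rho> \<le> \<sigma>" "p > 0"
  shows "H \<sigma> p \<le> H \<rho> p"
proof (rule DERIV_nonpos_imp_nonincreasing[OF \<open>\<rho> \<le> \<sigma>\<close>])
  fix x assume "\<rho> \<le> x" "x \<le> \<sigma>"
  then have "x > 0" using assms by simp
  then show "\<exists>d. ((\<lambda>r. H r p) has_real_derivative d) (at x) \<and> d \<le> 0"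
    using eos_chain[of "\<lambda>r. r" 1 x "\<lambda>_. p" 0] eos_partials(2)[of x p] assms by force
qed

lemma eos_small_pressure:
  assumes "\<rho> > 0" "h > 1"
  obtains e where "e > 0" "\<And>p. 0 < p \<Longrightarrow> p < e \<Longrightarrow> H \<rho> p < h"
proof -
  have "((\<lambda>p. H \<rho> p) \<longlongrightarrow> 1) (at_right 0)"
    using eos assms by (simp add: equation_of_state_def)
  then have "eventually (\<lambda>p. H \<rho> p < h) (at_right 0)"
    using \<open>h > 1\<close> by (rule order_tendstoD)
  then obtain e where "e > 0" "\<forall>p>0. p < e \<longrightarrow> H \<rho> p < h"
    by (auto simp: eventually_at_right_field)
  with that show ?thesis by blast
qed

text \<open>Condition (iv) puts \<open>H\<close> below \<open>h\<close> at small pressure, and the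
  bound \<open>2 * p / \<rho> < H \<rho> p\<close> puts it above \<open>h\<close> from
  \<open>p = \<rho> * h\<close> on. Strict monotonicity in the pressure makes the solution
  unique.\<close>

lemma pressure_eq_iff:
  assumes "\<rho> > 0" "h > 1"
  shows "pressure H \<rho> h = p \<longleftrightarrow> p > 0 \<and> H \<rho> p = h"
proof -
  obtain e where e: "e > 0" "\<And>p. 0 < p \<Longrightarrow> p < e \<Longrightarrow> H \<rho> p < h"
    using eos_small_pressure[OF assms] by blast
  define u where "u = e / 2"
  define v where "v = max u (\<rho> * h)"
  have uv: "0 < u" "u \<le> v" "H \<rho> u < h"
    using e by (auto simp: u_def v_def)
  have "h \<le> 2 * v / \<rho>"
    using assms uv by (simp add: v_def max_def field_simps)
  then have "h \<le> H \<rho> v" using eos_lower(1)[of \<rho> v] assms uv by simp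
  moreover have "continuous_on {u..v} (H \<rho>)"
    using assms uv
    by (intro continuous_at_imp_continuous_on ballI DERIV_isCont[OF eos_deriv_pressure]) auto
  ultimately obtain p0 where p0: "u \<le> p0" "H \<rho> p0 = h"
    using IVT'[of "H \<rho>" u h v] uv by auto
  have uniq: "q = p0" if "q > 0" "H \<rho> q = h" for q
    using eos_mono_pressure[of \<rho> q p0] eos_mono_pressure[of \<rho> p0 q] assms that p0 uv
    by (cases q p0 rule: linorder_cases) auto
  have "pressure H \<rho> h = p0"
    unfolding pressure_def using p0 uv uniq by (intro the_equality) auto
  then show ?thesis using p0 uv uniq by (metis order_less_le_trans)
qed

end

section \<open>Recovery of the primitive variables\<close>

text \<open>The letters \<open>b\<close>, \<open>m2\<close>, \<open>T\<close> stand for \<open>B\<^sup>2\<close>, \<open>m\<^sup>2\<close>, \<open>\<tau>\<^sup>2\<close>; \<open>T \<le> m2 * b\<close> is the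
  Cauchy-Schwarz inequality.\<close>

locale conserved_state =
  fixes D m2 b T E :: real
  assumes D: "D > 0" and m2: "m2 \<ge> 0" and b: "b \<ge> 0" and T: "T \<ge> 0" "T \<le> m2 * b"
    and energy_pos: "E > 0"
begin

text \<open>\<open>speed_sq\<close> is the squared norm of the velocity \<open>(m + (\<tau> / \<xi>) B) / (\<xi> + B\<^sup>2)\<close>, so that
  \<open>1 - speed_sq \<xi> = 1 / W(\<xi>)\<^sup>2\<close>.\<close>

definition speed_sq :: "real \<Rightarrow> real" where
  "speed_sq x = (m2 + T * (2 * x + b) / x\<^sup>2) / (x + b)\<^sup>2"

text \<open>The function \<open>master\<close> without its pressure term, with
  \<open>1 - speed_sq x\<close> for the inverse square of the Lorentz factor.\<close>

definition total :: "real \<Rightarrow> real" where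
  "total x = x - 1 / 2 * (b * (1 - speed_sq x) + T / x\<^sup>2) + b - E"

definition cubic :: "real \<Rightarrow> real" where
  "cubic x = x ^ 3 + (b - E) * x\<^sup>2 - (b * D\<^sup>2 + T) / 2"

section \<open>Monotonicity of the squared speed\<close>

lemma speed_sq_nonneg: "x > 0 \<Longrightarrow> speed_sq x \<ge> 0"
  using m2 b T by (simp add: speed_sq_def)

lemma speed_sq_eq:
  assumes "x > 0"
  shows "x\<^sup>2 * (x + b)\<^sup>2 * speed_sq x = x\<^sup>2 * m2 + (2 * x + b) * T"
proof -
  have "x + b > 0" using assms b by simp
  then show ?thesis using assms by (simp add: speed_sq_def field_simps)
qed

lemma speed_sq_deriv:
  assumes "x > 0"
  shows "(speed_sq has_real_derivative - 2 * (speed_sq x + T / x ^ 3) / (x + b)) (at x)"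
proof -
  have nz: "x + b > 0" using assms b by simp
  \<comment> \<open>The factor \<open>x + b\<close> splits off this derivative, so that one power of
    it cancels in the quotient rule.\<close>
  have "((\<lambda>x. m2 + T * (2 * x + b) / x\<^sup>2) has_real_derivative - (2 * (T / x ^ 3)) * (x + b)) (at x)"
    using assms
    by (auto intro!: derivative_eq_intros simp: power2_eq_square power3_eq_cube field_simps)
  moreover have "((\<lambda>x. (x + b)\<^sup>2) has_real_derivative 2 * (x + b)) (at x)"
    by (auto intro!: derivative_eq_intros)
  ultimately have "(speed_sq has_real_derivative
      (- (2 * (T / x ^ 3)) * (x + b) * (x + b)\<^sup>2 - (m2 + T * (2 * x + b) / x\<^sup>2) * (2 * (x + b)))
      / ((x + b)\<^sup>2 * (x + b)\<^sup>2)) (at x)"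
    unfolding speed_sq_def [abs_def] by (rule DERIV_divide) (use nz in simp)
  moreover have "m2 + T * (2 * x + b) / x\<^sup>2 = speed_sq x * (x + b)\<^sup>2"
    using nz by (simp add: speed_sq_def)
  moreover have "(- (2 * c) * u * u\<^sup>2 - v * u\<^sup>2 * (2 * u)) / (u\<^sup>2 * u\<^sup>2) = - 2 * (v + c) / u"
    if "u > 0" for c u v :: real
    using that by (simp add: power2_eq_square field_simps)
  ultimately show ?thesis using nz by metis
qed

lemma speed_sq_antimono:
  assumes "0 < x" "x \<le> y"
  shows "speed_sq y \<le> speed_sq x"
proof (rule DERIV_nonpos_imp_nonincreasing[OF \<open>x \<le> y\<close>])
  fix z assume "x \<le> z" "z \<le> y"
  then have "z > 0" using assms by simp
  moreover have "- 2 * (speed_sq z + T / z ^ 3) / (z + b) \<le> 0"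
  proof (rule divide_nonpos_pos)
    show "- 2 * (speed_sq z + T / z ^ 3) \<le> 0"
      using speed_sq_nonneg[OF \<open>z > 0\<close>] T \<open>z > 0\<close>
      by (intro mult_nonpos_nonneg add_nonneg_nonneg) auto
  qed (use b \<open>z > 0\<close> in simp)
  ultimately show "\<exists>d. (speed_sq has_real_derivative d) (at z) \<and> d \<le> 0"
    using speed_sq_deriv[of z] by blast
qed

text \<open>The expression is the square of \<xi>/W, and \<open>f_b\<close> is a positive multiple
  of its difference from \<open>D\<^sup>2\<close>.\<close>

lemma scaled_strict_mono:
  assumes "0 < x" "x < y" "speed_sq x < 1"
  shows "x\<^sup>2 * (1 - speed_sq x) < y\<^sup>2 * (1 - speed_sq y)"
proof (rule mult_less_le_imp_less)
  show "x\<^sup>2 < y\<^sup>2" using assms by (simp add: power_strict_mono)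
  show "1 - speed_sq x \<le> 1 - speed_sq y" using speed_sq_antimono[of x y] assms by simp
qed (use assms in auto)

section \<open>The root of \<open>f_b\<close>\<close>

lemma ex1_base_root: "\<exists>!x. x > 0 \<and> x\<^sup>2 * (1 - speed_sq x) = D\<^sup>2"
proof -
  have base_lt: "speed_sq x < 1" if "x\<^sup>2 * (1 - speed_sq x) = D\<^sup>2" for x
  proof -
    have "0 < x\<^sup>2 * (1 - speed_sq x)" using that D by simp
    then show ?thesis by (simp add: zero_less_mult_iff)
  qed
  \<comment> \<open>An upper end for the intermediate value theorem: by
    \<open>T \<le> m2 * b\<close> the term \<open>y\<^sup>2 * speed_sq y\<close> is at most
    \<open>m2\<close>, so the factor 3 leaves ample room.\<close>
  define y where "y = sqrt (D\<^sup>2 + 3 * m2)"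
  have y: "D \<le> y" "y\<^sup>2 = D\<^sup>2 + 3 * m2"
    using D m2 by (auto simp: y_def intro: real_le_rsqrt)
  have "y\<^sup>2 * speed_sq y \<le> 3 * m2"
  proof -
    have pos: "y > 0" "y + b > 0" using y D b by auto
    have "y\<^sup>2 * speed_sq y = (m2 * y\<^sup>2 + T * (2 * y + b)) / (y + b)\<^sup>2"
      using pos by (simp add: speed_sq_def field_simps)
    also have "\<dots> \<le> 3 * m2"
    proof -
      have "T * (2 * y + b) \<le> m2 * b * (2 * y + b)"
        using T b pos by (intro mult_right_mono) auto
      moreover have "0 \<le> m2 * (2 * y\<^sup>2 + 4 * y * b + 2 * b\<^sup>2)"
        using m2 b pos by simp
      ultimately have "m2 * y\<^sup>2 + T * (2 * y + b) \<le> 3 * m2 * (y + b)\<^sup>2"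
        by (simp add: power2_eq_square algebra_simps)
      then show ?thesis using pos by (simp add: divide_le_eq)
    qed
    finally show ?thesis .
  qed
  then have hi: "D\<^sup>2 \<le> y\<^sup>2 * (1 - speed_sq y)"
    using y by (simp add: algebra_simps)
  have lo: "D\<^sup>2 * (1 - speed_sq D) \<le> D\<^sup>2"
    using speed_sq_nonneg[of D] D by (simp add: algebra_simps)
  have "continuous_on {D..y} (\<lambda>x. x\<^sup>2 * (1 - speed_sq x))"
    using D
    by (intro continuous_intros continuous_at_imp_continuous_on ballI DERIV_isCont[OF speed_sq_deriv])
      auto
  then obtain x where x: "D \<le> x" "x\<^sup>2 * (1 - speed_sq x) = D\<^sup>2"
    using IVT'[of "\<lambda>x. x\<^sup>2 * (1 - speed_sq x)" D "D\<^sup>2" y] lo hi y by auto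
  then have "x > 0" using D by simp
  moreover have "z = x" if "z > 0" "z\<^sup>2 * (1 - speed_sq z) = D\<^sup>2" for z
    using scaled_strict_mono[of x z] scaled_strict_mono[of z x] that x \<open>x > 0\<close>
      base_lt[of x] base_lt[of z]
    by (cases x z rule: linorder_cases) auto
  ultimately show ?thesis using x by blast
qed

text \<open>This is \<open>xi_b\<close>. Membership in \<open>Omega1\<close> is automatic, because
  \<open>D\<^sup>2 > 0\<close> forces \<open>speed_sq x < 1\<close> at any solution.\<close>

definition base :: real where
  "base = (THE x. x > 0 \<and> x\<^sup>2 * (1 - speed_sq x) = D\<^sup>2)"

lemma base: "base > 0" "base\<^sup>2 * (1 - speed_sq base) = D\<^sup>2"
  using theI'[OF ex1_base_root] by (auto simp: base_def)

lemma base_eqI: "x > 0 \<Longrightarrow> x\<^sup>2 * (1 - speed_sq x) = D\<^sup>2 \<Longrightarrow> base = x"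
  using ex1_base_root base by blast

lemma speed_sq_base: "speed_sq base < 1"
proof -
  have "0 < base\<^sup>2 * (1 - speed_sq base)" using base D by simp
  then show ?thesis by (simp add: zero_less_mult_iff)
qed

lemma above_base:
  assumes "base < x"
  shows "x > 0" "speed_sq x < 1" "D\<^sup>2 < x\<^sup>2 * (1 - speed_sq x)"
  using assms base speed_sq_base speed_sq_antimono[of base x] scaled_strict_mono[of base x] by auto

text \<open>Writing \<open>(x + b)\<^sup>2\<close> as \<open>x\<^sup>2 + b * (2 * x + b)\<close> in
  the defining equation collects the data into \<open>D\<^sup>2 + m2\<close> and
  \<open>b * D\<^sup>2 + T\<close>, the combinations that occur in \<Psi> and
  \<open>f_c\<close>.\<close>

lemma base_eq: "base\<^sup>2 * (D\<^sup>2 + m2) + (2 * base + b) * (b * D\<^sup>2 + T) = base\<^sup>2 * (base + b)\<^sup>2"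
proof -
  have *: "base\<^sup>2 * speed_sq base = base\<^sup>2 - D\<^sup>2"
    using base by (simp add: algebra_simps)
  have "(base + b)\<^sup>2 * (base\<^sup>2 * speed_sq base) = base\<^sup>2 * m2 + (2 * base + b) * T"
    using speed_sq_eq[OF base(1)] by (simp add: mult_ac)
  then have "(base + b)\<^sup>2 * (base\<^sup>2 - D\<^sup>2) = base\<^sup>2 * m2 + (2 * base + b) * T"
    unfolding * .
  then show ?thesis by (simp add: power2_eq_square algebra_simps)
qed

section \<open>The positive root of the cubic\<close>

lemma cubic_eq: "cubic x = x\<^sup>2 * (x + b - E) - (b * D\<^sup>2 + T) / 2"
  by (simp add: cubic_def power2_eq_square power3_eq_cube algebra_simps)

text \<open>The cubic may decrease at first, as \<open>b - E\<close> can be negative. A nonnegative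
  value, however, forces \<open>x + b - E \<ge> 0\<close>, and from there on the product with
  \<open>x\<^sup>2\<close> increases.\<close>

lemma cubic_pos_mono:
  assumes "0 < x" "x < y" "0 \<le> cubic x"
  shows "0 < cubic y"
proof -
  define s where "s = (b * D\<^sup>2 + T) / 2"
  have s: "s \<ge> 0" using b T by (simp add: s_def)
  have "0 \<le> x\<^sup>2 * (x + b - E) - s"
    using assms by (simp add: cubic_eq s_def)
  then have "0 \<le> x\<^sup>2 * (x + b - E)" "s \<le> x\<^sup>2 * (x + b - E)" using s by auto
  then have "0 \<le> x + b - E" using assms by (simp add: zero_le_mult_iff)
  then have "x\<^sup>2 * (x + b - E) \<le> y\<^sup>2 * (x + b - E)"
    using assms by (intro mult_right_mono power_mono) auto
  also have "\<dots> < y\<^sup>2 * (y + b - E)" using assms by simp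
  finally have "s < y\<^sup>2 * (y + b - E)" using \<open>s \<le> _\<close> by simp
  then show ?thesis
    by (simp add: cubic_eq s_def)
qed

lemma ex1_cubic_root: "\<exists>!x. x > 0 \<and> cubic x = 0"
proof -
  define s where "s = (b * D\<^sup>2 + T) / 2"
  have s: "s \<ge> 0" using b T by (simp add: s_def)
  have cubic: "cubic x = x\<^sup>2 * (x + b - E) - s" for x
    by (simp add: cubic_eq s_def)
  \<comment> \<open>For \<open>b = 0\<close> also \<open>T = 0\<close>, so the cubic vanishes at 0
    and a positive witness such as \<open>E\<close> is required. Otherwise the constant term is
    negative and dominates near 0.\<close>
  obtain u where u: "u > 0" "cubic u \<le> 0"
  proof (cases "b = 0")
    case True
    then have "cubic E \<le> 0" unfolding cubic using s by simp
    with energy_pos that show ?thesis by blast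
  next
    case False
    then have sp: "s > 0" using b D T by (simp add: s_def add_pos_nonneg)
    define u where "u = min 1 (s / (1 + b))"
    have "u \<le> s / (1 + b)" by (simp add: u_def)
    then have "u * (1 + b) \<le> s" using b by (simp add: pos_le_divide_eq)
    moreover have "0 < u" "u \<le> 1" using sp b by (simp_all add: u_def)
    ultimately have u: "0 < u" "u \<le> 1" "u * (1 + b) \<le> s" by simp_all
    have "u\<^sup>2 * (u + b - E) \<le> u\<^sup>2 * (1 + b)"
      using u energy_pos by (intro mult_left_mono) auto
    also have "\<dots> \<le> u * (1 + b)"
      using u b by (intro mult_right_mono) (auto simp: power2_eq_square mult_le_cancel_left1)
    finally have "cubic u \<le> 0" using u by (simp add: cubic)
    with u that show ?thesis by blast
  qed
  define v where "v = max u (1 + E + s)"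
  have v: "u \<le> v" "1 \<le> v" "1 + E + s \<le> v"
    using s energy_pos by (auto simp: v_def)
  have "s \<le> 1 * (v + b - E)" using v b by simp
  also have "\<dots> \<le> v\<^sup>2 * (v + b - E)"
    using v b s by (intro mult_right_mono) auto
  finally have "0 \<le> cubic v" by (simp add: cubic)
  moreover have "continuous_on {u..v} cubic"
    unfolding cubic_def [abs_def] by (intro continuous_intros)
  ultimately obtain x where x: "u \<le> x" "cubic x = 0"
    using IVT'[of cubic u 0 v] u v by auto
  have "z = x" if "z > 0" "cubic z = 0" for z
    using cubic_pos_mono[of x z] cubic_pos_mono[of z x] that x u
    by (cases x z rule: linorder_cases) auto
  with x u show ?thesis by (intro ex1I[of _ x]) auto
qed

text \<open>With \<open>z = (\<Phi> - 2 (b - E)) / 3\<close> and \<open>t = (\<Phi> + b - E) / 3\<close> the condition \<open>\<Psi> > 0\<close> reads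
  \<open>2 t z\<^sup>2 > s\<close> for \<open>s = b D\<^sup>2 + T\<close>, while \<open>E = z + b - t\<close> and
  \<open>D\<^sup>2 + m2 = (z + b)\<^sup>2 - 2 t (2 z + b)\<close>. The point \<open>x = base\<close> satisfies
  \<open>D\<^sup>2 + m2 = (x + b)\<^sup>2 - 2 u (2 x + b)\<close> with \<open>2 u x\<^sup>2 = s\<close>. Comparison yields first \<open>x < z\<close> and
  then \<open>E > x + b - u\<close>, which is the claim.\<close>

lemma cubic_base_neg:
  assumes E: "E > sqrt (D\<^sup>2 + m2)"
  defines "P \<equiv> sqrt ((b - E)\<^sup>2 + 3 * (E\<^sup>2 - D\<^sup>2 - m2))"
  assumes Psi: "(P - 2 * (b - E)) * sqrt (P + b - E) - sqrt (27 / 2 * (D\<^sup>2 * b + T)) > 0"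
  shows "cubic base < 0"
proof -
  define s where "s = b * D\<^sup>2 + T"
  define z where "z = (P - 2 * (b - E)) / 3"
  define t where "t = (P + b - E) / 3"
  define x where "x = base"
  \<comment> \<open>This is 2 u in the notation of the text before the lemma.\<close>
  define \<sigma> where "\<sigma> = s / x\<^sup>2"
  have s: "s \<ge> 0" using b T by (simp add: s_def)
  have x: "x > 0" using base by (simp add: x_def)
  have \<sigma>: "\<sigma> \<ge> 0" using s by (simp add: \<sigma>_def)
  have "(sqrt (D\<^sup>2 + m2))\<^sup>2 < E\<^sup>2"
    using E m2 by (intro power_strict_mono) auto
  then have A: "E\<^sup>2 - D\<^sup>2 - m2 > 0" using m2 by simp
  then have P2: "P\<^sup>2 = (b - E)\<^sup>2 + 3 * (E\<^sup>2 - D\<^sup>2 - m2)" unfolding P_def by simp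
  have Ps: "sqrt (27 / 2 * s) < 3 * z * sqrt (3 * t)"
  proof -
    have "P - 2 * (b - E) = 3 * z" "P + b - E = 3 * t" "D\<^sup>2 * b + T = s"
      by (simp_all add: z_def t_def s_def)
    with Psi show ?thesis by simp
  qed
  moreover have "0 \<le> sqrt (27 / 2 * s)" using s by simp
  ultimately have prod: "0 < 3 * z * sqrt (3 * t)" by linarith
  \<comment> \<open>Since \<open>sqrt\<close> is negative on negative arguments, the product could
    be positive with both factors negative; this excludes that case.\<close>
  have "sqrt (3 * t) \<ge> 0"
  proof -
    have "\<bar>b - E\<bar> \<le> P" unfolding P_def using A by (intro real_le_rsqrt) simp
    then show ?thesis by (simp add: t_def)
  qed
  with prod have z: "z > 0" and t: "t > 0"
    by (auto simp: zero_less_mult_iff)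
  have Eq: "E = z + b - t" by (simp add: z_def t_def field_simps)
  have dq: "D\<^sup>2 + m2 = (z + b)\<^sup>2 - 2 * t * (2 * z + b)"
  proof -
    have "P = z + 2 * t" by (simp add: z_def t_def field_simps)
    with P2 Eq have "(z + 2 * t)\<^sup>2 = (t - z)\<^sup>2 + 3 * ((z + b - t)\<^sup>2 - (D\<^sup>2 + m2))"
      by (simp add: power2_commute)
    then show ?thesis by (simp add: power2_eq_square algebra_simps)
  qed
  have "(sqrt (27 / 2 * s))\<^sup>2 < (3 * z * sqrt (3 * t))\<^sup>2"
    using Ps s by (intro power_strict_mono) auto
  then have st: "s < 2 * t * z\<^sup>2"
    using s t by (simp add: power_mult_distrib)
  have dx: "D\<^sup>2 + m2 = (x + b)\<^sup>2 - \<sigma> * (2 * x + b)"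
  proof -
    have *: "x\<^sup>2 * \<sigma> = s" using x by (simp add: \<sigma>_def)
    have "x\<^sup>2 * ((x + b)\<^sup>2 - \<sigma> * (2 * x + b))
        = x\<^sup>2 * (x + b)\<^sup>2 - (2 * x + b) * (x\<^sup>2 * \<sigma>)"
      by (simp add: right_diff_distrib mult_ac)
    then have "x\<^sup>2 * ((x + b)\<^sup>2 - \<sigma> * (2 * x + b)) = x\<^sup>2 * (x + b)\<^sup>2 - (2 * x + b) * s"
      unfolding * .
    then have "x\<^sup>2 * (D\<^sup>2 + m2) = x\<^sup>2 * ((x + b)\<^sup>2 - \<sigma> * (2 * x + b))"
      using base_eq by (simp add: s_def x_def)
    then show ?thesis using x by simp
  qed
  \<comment> \<open>The function \<open>(y + b)\<^sup>2 - s * (2 / y + b / y\<^sup>2)\<close> of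
    \<open>y > 0\<close> is increasing. It equals \<open>D\<^sup>2 + m2\<close> at \<open>x\<close>
    and, by \<open>st\<close>, exceeds that at \<open>z\<close>.\<close>
  have "x < z"
  proof (rule ccontr)
    assume "\<not> x < z"
    then have zx: "z \<le> x" by simp
    have "s / z\<^sup>2 < 2 * t" using st z by (simp add: divide_less_eq)
    then have "D\<^sup>2 + m2 < (z + b)\<^sup>2 - s / z\<^sup>2 * (2 * z + b)"
      unfolding dq using z b by (intro diff_strict_left_mono mult_strict_right_mono) auto
    also have "\<dots> = (z + b)\<^sup>2 - s * (2 / z + b / z\<^sup>2)"
      using z by (simp add: power2_eq_square field_simps)
    also have "\<dots> \<le> (x + b)\<^sup>2 - s * (2 / x + b / x\<^sup>2)"
      using z zx b s by (intro diff_mono mult_left_mono add_mono power_mono divide_left_mono) auto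
    also have "\<dots> = (x + b)\<^sup>2 - \<sigma> * (2 * x + b)"
      using x by (simp add: \<sigma>_def power2_eq_square field_simps)
    finally show False using dx by simp
  qed
  \<comment> \<open>The difference of \<open>dx\<close> and \<open>dq\<close>, arranged so that
    \<open>2 * z + b\<close> can be cancelled after the estimate.\<close>
  have "(2 * t - \<sigma>) * (2 * z + b) = (z - x) * (z + x + 2 * b - 2 * \<sigma>)"
    using dx dq by (simp add: power2_eq_square algebra_simps)
  also have "\<dots> < (z - x) * (2 * (2 * z + b))"
    using \<open>x < z\<close> x \<sigma> by (intro mult_strict_left_mono) auto
  also have "\<dots> = 2 * (z - x) * (2 * z + b)" by (simp only: mult_ac)
  finally have "2 * t - \<sigma> < 2 * (z - x)"
    by (rule mult_right_less_imp_less) (use z b in simp)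
  then have "x + b - E < \<sigma> / 2" using Eq by simp
  then have "x\<^sup>2 * (x + b - E) < x\<^sup>2 * (\<sigma> / 2)"
    using x by (intro mult_strict_left_mono) auto
  also have "\<dots> = s / 2" using x by (simp add: \<sigma>_def)
  finally show ?thesis
    by (simp add: cubic_eq s_def x_def)
qed

section \<open>Master function plus pressure, and the roots of the master function\<close>

lemma total_deriv:
  assumes "x > 0"
  shows "(total has_real_derivative
           x * ((speed_sq x + T / x ^ 3) / (x + b)) + (1 - speed_sq x)) (at x)"
proof -
  have nz: "x + b > 0" using assms b by simp
  define v where "v = speed_sq x"
  define c where "c = T / x ^ 3"
  have "((\<lambda>x. T / x\<^sup>2) has_real_derivative - (2 * c)) (at x)"
    using assms unfolding c_def
    by (auto intro!: derivative_eq_intros simp: power2_eq_square power3_eq_cube field_simps)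
  moreover have "(speed_sq has_real_derivative - 2 * (v + c) / (x + b)) (at x)"
    using speed_sq_deriv[OF assms] by (simp add: v_def c_def)
  ultimately have "(total has_real_derivative
      1 - 1 / 2 * (b * (0 - (- 2 * (v + c) / (x + b))) + - (2 * c)) + 0 - 0) (at x)"
    unfolding total_def [abs_def]
    by (intro DERIV_diff DERIV_add DERIV_ident DERIV_cmult DERIV_const)
  \<comment> \<open>Replacing \<open>b / (x + b)\<close> by \<open>1 - x / (x + b)\<close> leaves a
    sum of terms that are nonnegative wherever \<open>v \<le> 1\<close>.\<close>
  moreover have "1 - 1 / 2 * (b * (0 - (- 2 * (v + c) / (x + b))) + - (2 * c)) + 0 - 0
      = x * ((v + c) / (x + b)) + (1 - v)"
    using nz by (simp add: field_simps)
  ultimately have "(total has_real_derivative x * ((v + c) / (x + b)) + (1 - v)) (at x)"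
    by (simp only:)
  then show ?thesis unfolding v_def c_def .
qed

lemma total_strict_mono:
  assumes "base < x" "x < y"
  shows "total x < total y"
proof (rule DERIV_pos_imp_increasing[OF \<open>x < y\<close>])
  fix z assume "x \<le> z" "z \<le> y"
  then have z: "z > 0" "speed_sq z < 1" using above_base[of z] assms by auto
  then have "0 \<le> z * ((speed_sq z + T / z ^ 3) / (z + b))"
    using b T speed_sq_nonneg[of z] by simp
  with z show "\<exists>d. (total has_real_derivative d) (at z) \<and> 0 < d"
    using total_deriv[of z] by (metis add_nonneg_pos diff_gt_0_iff_gt)
qed

lemma continuous_on_total: "base < x \<Longrightarrow> continuous_on {x..y} total"
  using base by (intro continuous_at_imp_continuous_on ballI DERIV_isCont[OF total_deriv]) auto

lemma total_nonpos_at_cubic_root: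
  assumes "base < x" "cubic x = 0"
  shows "total x \<le> 0"
proof -
  note x = above_base[OF assms(1)]
  have "x\<^sup>2 * total x = cubic x - b / 2 * (x\<^sup>2 * (1 - speed_sq x) - D\<^sup>2)"
    using x(1) by (simp add: total_def cubic_def power2_eq_square power3_eq_cube field_simps)
  also have "\<dots> \<le> 0" using x assms b by simp
  finally show ?thesis using x(1) by (simp add: mult_le_0_iff)
qed

text \<open>Since \<open>total \<xi>\<close> is the master function plus the pressure, the roots of the master function are
  the points with \<open>total \<xi> > 0\<close> where the following difference of enthalpies vanishes. This
  avoids differentiating the implicitly defined pressure.\<close>

definition defect :: "(real \<Rightarrow> real \<Rightarrow> real) \<Rightarrow> real \<Rightarrow> real" where
  "defect H x = H (D * sqrt (1 - speed_sq x)) (total x) - x * sqrt (1 - speed_sq x) / D"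

text \<open>The square root of the third fact of \<open>above_base\<close>. It places the enthalpy
  argument of \<open>pressure\<close> in the range where \<open>pressure_eq_iff\<close>
  applies.\<close>

lemma enthalpy_gt_1:
  assumes "base < x"
  shows "1 < x * sqrt (1 - speed_sq x) / D"
proof -
  note x = above_base[OF assms]
  have "sqrt (D\<^sup>2) < sqrt (x\<^sup>2 * (1 - speed_sq x))" using x(3) by (rule real_sqrt_less_mono)
  then have "D < x * sqrt (1 - speed_sq x)"
    using x(1) D by (simp add: real_sqrt_mult)
  then show ?thesis using D by simp
qed

text \<open>At a zero of \<open>defect\<close> the value of \<open>H\<close> is known explicitly, so
  condition (iii) becomes a lower bound for the density derivative; hence the sign is claimed only
  there.\<close>

lemma defect_deriv:
  assumes "equation_of_state H" "base < x" "total x > 0"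
  obtains d where "(defect H has_real_derivative d) (at x)" "defect H x = 0 \<Longrightarrow> d > 0"
proof -
  note x = above_base[OF assms(2)]
  define a where "a = sqrt (1 - speed_sq x)"
  define w where "w = (speed_sq x + T / x ^ 3) / (x + b)"
  define a' where "a' = w / a"
  have a: "a > 0" "a\<^sup>2 = 1 - speed_sq x" using x by (simp_all add: a_def)
  have "x + b > 0" using x b by simp
  then have w: "w \<ge> 0" using x T speed_sq_nonneg[OF x(1)] by (simp add: w_def)
  have a': "a' \<ge> 0" "a * a' = w" using w a by (simp_all add: a'_def)
  have "- 2 * (speed_sq x + T / x ^ 3) / (x + b) = - (2 * w)"
    by (simp only: w_def times_divide_eq_right mult_minus_left minus_divide_left)
  then have "(speed_sq has_real_derivative - (2 * w)) (at x)"
    using speed_sq_deriv[OF x(1)] by (simp only:)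
  from DERIV_diff[OF DERIV_const this, of 1]
  have dR: "((\<lambda>x. 1 - speed_sq x) has_real_derivative 2 * w) (at x)" by simp
  have "1 - speed_sq x > 0" using x by simp
  from DERIV_chain2[OF DERIV_real_sqrt[OF this] dR]
  have "((\<lambda>x. sqrt (1 - speed_sq x)) has_real_derivative inverse a / 2 * (2 * w)) (at x)"
    unfolding a_def .
  moreover have "inverse a / 2 * (2 * w) = a'"
    using a(1) by (simp add: a'_def field_simps)
  ultimately have da: "((\<lambda>x. sqrt (1 - speed_sq x)) has_real_derivative a') (at x)"
    by (simp only:)
  have dt: "(total has_real_derivative x * w + a\<^sup>2) (at x)"
    using total_deriv[OF x(1)] by (simp add: w_def a)
  define \<rho> p where "\<rho> = D * a" and "p = total x"
  have \<rho>: "\<rho> > 0" using D a by (simp add: \<rho>_def)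
  have p: "p > 0" using assms by (simp add: p_def)
  define r q where "r = deriv (\<lambda>s. H s p) \<rho>" and "q = deriv (\<lambda>s. H \<rho> s) p"
  have "((\<lambda>x. D * sqrt (1 - speed_sq x)) has_real_derivative D * a') (at x)"
    by (rule DERIV_cmult[OF da])
  from eos_chain[OF assms(1) this dt]
  have "((\<lambda>x. H (D * sqrt (1 - speed_sq x)) (total x)) has_real_derivative
      r * (D * a') + q * (x * w + a\<^sup>2)) (at x)"
    using \<rho> p by (simp add: r_def q_def \<rho>_def p_def a_def)
  moreover have "((\<lambda>x. x * sqrt (1 - speed_sq x) / D) has_real_derivative (1 * a + a' * x) / D) (at x)"
    using DERIV_cdivide[OF DERIV_mult[OF DERIV_ident da]] by (simp add: a_def)
  ultimately have "(defect H has_real_derivative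
      r * (D * a') + q * (x * w + a\<^sup>2) - (1 * a + a' * x) / D) (at x)"
    unfolding defect_def [abs_def] by (rule DERIV_diff)
  moreover have "0 < r * (D * a') + q * (x * w + a\<^sup>2) - (1 * a + a' * x) / D" if "defect H x = 0"
  proof -
    have h: "H \<rho> p = x * a / D" using that by (simp add: defect_def \<rho>_def p_def a_def)
    \<comment> \<open>With \<open>\<rho> = D * a\<close> and \<open>a * a' = w\<close>, this bound
      cancels both \<open>q * (x * w)\<close> and \<open>x * a' / D\<close>. What remains is
      \<open>q * a\<^sup>2 - a / D\<close>, positive by \<open>1 / \<rho> < q\<close>.\<close>
    have "x * a / D * (1 / \<rho> - q) * (D * a') \<le> r * (D * a')"
      using eos_partials(1)[OF assms(1) \<rho> p] D a' by (intro mult_right_mono) (auto simp: h r_def q_def)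
    moreover have "x * a / D * (1 / \<rho> - q) * (D * a') = x * a' / D - q * (x * w)"
      using D a unfolding a'(2)[symmetric] by (simp add: \<rho>_def field_simps)
    moreover have "a / D < q * a\<^sup>2"
    proof -
      have "1 / \<rho> * a\<^sup>2 < q * a\<^sup>2"
        using eos_partials(3)[OF assms(1) \<rho> p] a(1) by (intro mult_strict_right_mono) (auto simp: q_def)
      moreover have "1 / \<rho> * a\<^sup>2 = a / D"
        using a(1) D by (simp add: \<rho>_def power2_eq_square)
      ultimately show ?thesis by simp
    qed
    moreover have "(1 * a + a' * x) / D = a / D + x * a' / D"
      by (simp add: add_divide_distrib mult.commute)
    ultimately show ?thesis by (simp add: distrib_left)
  qed
  ultimately show ?thesis using that by blast
qed

lemma continuous_on_defect:
  assumes "equation_of_state H" "base < x" "total x > 0"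
  shows "continuous_on {x..y} (defect H)"
proof (intro continuous_at_imp_continuous_on ballI)
  fix z assume "z \<in> {x..y}"
  then have "base < z" "total z > 0"
    using assms total_strict_mono[of x z] by (auto simp: order_le_less)
  then obtain d where "(defect H has_real_derivative d) (at z)"
    using defect_deriv[OF assms(1)] by blast
  then show "isCont (defect H) z" by (rule DERIV_isCont)
qed

lemma defect_root_unique:
  assumes "equation_of_state H"
    and "base < x" "total x > 0" "defect H x = 0"
    and "base < y" "total y > 0" "defect H y = 0"
  shows "x = y"
proof -
  have "u = v" if "u \<le> v" "base < u" "total u > 0" "defect H u = 0" "defect H v = 0" for u v
  proof (rule zero_unique_if_deriv_pos[OF that(1,4,5)])
    show "continuous_on {u..v} (defect H)"
      using continuous_on_defect assms(1) that by blast
    fix z assume "u \<le> z" "z \<le> v" "defect H z = 0"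
    moreover from this have "base < z" "total z > 0"
      using that total_strict_mono[of u z] by (auto simp: order_le_less)
    ultimately show "\<exists>d>0. (defect H has_real_derivative d) (at z)"
      using defect_deriv[OF assms(1), of z] by blast
  qed
  from this[of x y] this[of y x] assms show ?thesis by linarith
qed

text \<open>Just beyond the zero of \<open>total\<close> the pressure is small, so \<open>H\<close>
  stays below the required enthalpy; far out \<open>H\<close> exceeds it. The root lies
  between.\<close>

lemma defect_root_exists:
  assumes eos: "equation_of_state H" and c: "base < c" "total c \<le> 0"
  obtains x where "base < x" "total x > 0" "defect H x = 0"
proof -
  \<comment> \<open>Large enough for \<open>total X > X / 2\<close>, so that
    \<open>2 * total X / (D * a)\<close> exceeds \<open>X * a / D\<close>.\<close>
  define X where "X = max (c + 1) (max 1 (2 * (E + T) + 1))"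
  have X: "c < X" "1 \<le> X" "2 * (E + T) < X" by (auto simp: X_def)
  then have bX: "base < X" using c by simp
  note abX = above_base[OF bX]
  have tX: "X / 2 < total X"
  proof -
    have "T / X\<^sup>2 \<le> T" using X T by (simp add: divide_le_eq mult_le_cancel_left1)
    moreover have "b * (1 - speed_sq X) \<le> b"
      using b speed_sq_nonneg[of X] abX by (simp add: mult_left_le)
    moreover have "X / 2 < X - 1 / 2 * (q + r) + b - E" if "r \<le> T" "q \<le> b" for q r
      using that X T b by (simp add: field_simps)
    ultimately show ?thesis unfolding total_def by blast
  qed
  with X have tX0: "0 < total X" by simp
  have dX: "0 < defect H X"
  proof -
    define a where "a = sqrt (1 - speed_sq X)"
    have a: "0 < a" "a \<le> 1" using abX speed_sq_nonneg[of X] by (auto simp: a_def)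
    have "a * a \<le> 1" using a by (intro mult_le_one) auto
    then have "X * a \<le> X / a" using a X by (simp add: field_simps)
    then have "X * a / D \<le> X / a / D" using D by (intro divide_right_mono) auto
    also have "\<dots> < 2 * total X / (D * a)"
      using tX a D by (simp add: field_simps)
    also have "\<dots> < H (D * a) (total X)"
      using eos_lower(1)[OF eos, of "D * a" "total X"] D a tX0 by simp
    finally show ?thesis by (simp add: defect_def a_def)
  qed
  obtain z where z: "c \<le> z" "z \<le> X" "total z = 0"
    using IVT'[of total c 0 X] c tX0 X continuous_on_total[OF c(1)] by auto
  have bz: "base < z" using c z by simp
  have zX: "z < X" using z tX0 by (cases "z = X") auto
  \<comment> \<open>Condition (iv) is a limit at fixed density, so the threshold \<open>e\<close> is
    chosen for the density at \<open>z\<close>. At the later point \<open>s\<close> the density is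
    no smaller, which only lowers \<open>H\<close>.\<close>
  define \<rho> where "\<rho> = D * sqrt (1 - speed_sq z)"
  have \<rho>: "\<rho> > 0" using D above_base[OF bz] by (simp add: \<rho>_def)
  obtain e where e: "e > 0" "\<And>p. 0 < p \<Longrightarrow> p < e \<Longrightarrow> H \<rho> p < z * sqrt (1 - speed_sq z) / D"
    using eos_small_pressure[OF eos \<rho> enthalpy_gt_1[OF bz]] by blast
  define v where "v = min (e / 2) (total X)"
  have v: "0 < v" "v < e" "v \<le> total X" using e tX0 by (auto simp: v_def)
  obtain s where s: "z \<le> s" "s \<le> X" "total s = v"
    using IVT'[of total z v X] z v zX continuous_on_total[OF bz] by auto
  have bs: "base < s" using bz s by simp
  note abs = above_base[OF bs] and abz = above_base[OF bz]
  have sq: "sqrt (1 - speed_sq z) \<le> sqrt (1 - speed_sq s)"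
    using speed_sq_antimono[of z s] abz s by simp
  have "H (D * sqrt (1 - speed_sq s)) v \<le> H \<rho> v"
    unfolding \<rho>_def using sq D v \<rho> by (intro eos_antimono_density[OF eos]) (auto simp: \<rho>_def)
  also have "\<dots> < z * sqrt (1 - speed_sq z) / D" using e v by simp
  also have "\<dots> \<le> s * sqrt (1 - speed_sq s) / D"
    using sq s abz D by (intro divide_right_mono mult_mono) auto
  finally have ds: "defect H s < 0" using s by (simp add: defect_def)
  obtain x where x: "s \<le> x" "defect H x = 0"
    using IVT'[of "defect H" s 0 X] ds dX s v continuous_on_defect[OF eos bs] by auto
  have "base < x" using bs x by simp
  moreover have "total x > 0"
    using total_strict_mono[OF bs, of x] x s v by (cases "s = x") auto
  ultimately show ?thesis using that x by blast
qed

end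

section \<open>Conserved states as real vectors\<close>

lemma admissible_conserved_state:
  assumes "U \<in> admissible"
  shows "conserved_state (dens U) ((norm (mom U))\<^sup>2) ((norm (mag U))\<^sup>2) ((tau U)\<^sup>2) (energy U)"
proof
  show "(tau U)\<^sup>2 \<le> (norm (mom U))\<^sup>2 * (norm (mag U))\<^sup>2"
    using Cauchy_Schwarz_ineq[of "mom U" "mag U"] by (simp add: tau_def power2_norm_eq_inner)
  have "0 \<le> sqrt ((dens U)\<^sup>2 + (norm (mom U))\<^sup>2)" by simp
  moreover have "sqrt ((dens U)\<^sup>2 + (norm (mom U))\<^sup>2) < energy U"
    using assms by (simp add: admissible_def)
  ultimately show "energy U > 0" by linarith
qed (use assms in \<open>auto simp: admissible_def\<close>)

context
  fixes U :: conserved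
  assumes U: "U \<in> admissible"
begin

interpretation conserved_state "dens U" "(norm (mom U))\<^sup>2" "(norm (mag U))\<^sup>2" "(tau U)\<^sup>2" "energy U"
  using U by (rule admissible_conserved_state)

lemma f_a_eq:
  assumes "x > 0"
  shows "f_a U x = x\<^sup>2 * (x + (norm (mag U))\<^sup>2)\<^sup>2 * (1 - speed_sq x)"
  using speed_sq_eq[OF assms] by (simp add: f_a_def right_diff_distrib)

lemma Omega1_iff: "x \<in> Omega1 U \<longleftrightarrow> x > 0 \<and> speed_sq x < 1"
proof -
  have "x + (norm (mag U))\<^sup>2 > 0" if "x > 0" using that by (simp add: add_pos_nonneg)
  then show ?thesis by (auto simp: Omega1_def f_a_eq zero_less_mult_iff mult_less_0_iff)
qed

lemma xi_b_eq: "xi_b U = base"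
proof -
  have "f_b U x = (x + (norm (mag U))\<^sup>2)\<^sup>2 * (x\<^sup>2 * (1 - speed_sq x) - (dens U)\<^sup>2)" if "x > 0" for x
    using that by (simp add: f_b_def f_a_eq right_diff_distrib mult_ac)
  moreover have "x + (norm (mag U))\<^sup>2 > 0" if "x > 0" for x
    using that by (simp add: add_pos_nonneg)
  ultimately have f_b: "f_b U x = 0 \<longleftrightarrow> x\<^sup>2 * (1 - speed_sq x) = (dens U)\<^sup>2" if "x > 0" for x
    using that by (metis eq_iff_diff_eq_0 mult_eq_0_iff order_less_irrefl power_not_zero)
  show ?thesis
    unfolding xi_b_def
  proof (rule the_equality)
    show "base \<in> Omega1 U \<and> f_b U base = 0"
      using base speed_sq_base f_b by (simp add: Omega1_iff)
    show "x = base" if "x \<in> Omega1 U \<and> f_b U x = 0" for x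
      using that by (metis Omega1_iff base_eqI f_b)
  qed
qed

lemma lorentz_eq:
  assumes "x > 0" "speed_sq x < 1"
  shows "lorentz U x = 1 / sqrt (1 - speed_sq x)"
proof -
  have "x + (norm (mag U))\<^sup>2 > 0" using assms by (simp add: add_pos_nonneg)
  then show ?thesis using assms by (simp add: lorentz_def f_a_eq real_sqrt_mult)
qed

text \<open>A root means that \<open>total x\<close> is the pressure, which
  \<open>pressure_eq_iff\<close> characterises without the definite description.\<close>

lemma master_root_iff:
  assumes "equation_of_state H" "base < x"
  shows "master H U x = 0 \<longleftrightarrow> total x > 0 \<and> defect H x = 0"
proof -
  note x = above_base[OF assms(2)]
  define a where "a = sqrt (1 - speed_sq x)"
  have a: "a > 0" "a\<^sup>2 = 1 - speed_sq x" using x by (simp_all add: a_def)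
  have W: "lorentz U x = 1 / a" using x by (simp add: lorentz_eq a_def)
  have D: "dens U > 0" using U by (simp add: admissible_def)
  have "master H U x = total x - pressure H (dens U * a) (x * a / dens U)"
    by (simp add: master_def total_def W a(2)[symmetric] power_divide)
  moreover have "pressure H (dens U * a) (x * a / dens U) = total x \<longleftrightarrow>
      total x > 0 \<and> H (dens U * a) (total x) = x * a / dens U"
    using a D enthalpy_gt_1[OF assms(2)] by (intro pressure_eq_iff[OF assms(1)]) (auto simp: a_def)
  ultimately show ?thesis by (auto simp: defect_def a_def)
qed

lemma xi_c: "xi_c U > 0" "cubic (xi_c U) = 0"
proof -
  have "f_c U = cubic" by (auto simp: f_c_def cubic_def)
  then show "xi_c U > 0" "cubic (xi_c U) = 0"
    using theI'[OF ex1_cubic_root] by (auto simp: xi_c_def)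
qed

lemma base_less_xi_c: "base < xi_c U"
proof -
  have "cubic base < 0"
  proof (rule cubic_base_neg)
    show "energy U > sqrt ((dens U)\<^sup>2 + (norm (mom U))\<^sup>2)"
      using U by (simp add: admissible_def)
    show "(sqrt (((norm (mag U))\<^sup>2 - energy U)\<^sup>2 + 3 * ((energy U)\<^sup>2 - (dens U)\<^sup>2 - (norm (mom U))\<^sup>2))
        - 2 * ((norm (mag U))\<^sup>2 - energy U))
        * sqrt (sqrt (((norm (mag U))\<^sup>2 - energy U)\<^sup>2 + 3 * ((energy U)\<^sup>2 - (dens U)\<^sup>2 - (norm (mom U))\<^sup>2))
            + (norm (mag U))\<^sup>2 - energy U)
        - sqrt (27 / 2 * ((dens U)\<^sup>2 * (norm (mag U))\<^sup>2 + (tau U)\<^sup>2)) > 0"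
      using U by (simp add: admissible_def Psi_def Phi_def)
  qed
  then show ?thesis
    using xi_c cubic_pos_mono[of "xi_c U" base] by (cases "xi_c U" base rule: linorder_cases) auto
qed

text \<open>Existence and uniqueness behind \<open>xi_star\<close> are settled here through
  \<open>defect\<close>; \<open>xi_c U\<close> itself is the point with \<open>total \<le> 0\<close>
  from which the existence argument starts.\<close>

lemma xi_c_le_xi_star:
  assumes "equation_of_state H"
  shows "xi_c U \<le> xi_star H U"
proof -
  have tc: "total (xi_c U) \<le> 0"
    using total_nonpos_at_cubic_root base_less_xi_c xi_c by blast
  obtain x where x: "base < x" "total x > 0" "defect H x = 0"
    using defect_root_exists[OF assms base_less_xi_c tc] by blast
  have "xi_star H U = x"
    unfolding xi_star_def Omega2_def xi_b_eq greaterThan_iff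
  proof (rule the_equality)
    show "base < x \<and> master H U x = 0"
      using x master_root_iff[OF assms] by simp
    show "y = x" if "base < y \<and> master H U y = 0" for y
      using that x master_root_iff[OF assms] defect_root_unique[OF assms] by blast
  qed
  moreover have "xi_c U \<le> x"
    using total_strict_mono[of x "xi_c U"] x tc by (cases "x < xi_c U") auto
  ultimately show ?thesis by simp
qed

end

theorem theorem3p14:
  fixes H :: "real \<Rightarrow> real \<Rightarrow> real" and U :: conserved
  assumes "equation_of_state H"
    and "U \<in> admissible"
  shows "xi_c U \<in> Omega3 H U"
  using xi_b_eq[OF assms(2)] base_less_xi_c[OF assms(2)] xi_c_le_xi_star[OF assms(2,1)]
  by (simp add: Omega3_def)

end
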